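(* Let $f(z)=z+a_2z^2+a_3z^3+\cdots$ be analytic and univalent in the unit disk $\mathbb{D}=\{z:|z|<1\}$ with $a_2=0$, and let $f^{-1}(w)=w+A_2w^2+A_3w^3+A_4w^4+A_5w^5+\cdots$ be the expansion of its inverse function near $w=0$. Set $H_2(3)(f^{-1})=A_3A_5-A_4^2$. Then $$|H_2(3)(f^{-1})|\le \frac{\sqrt{3}}{6\sqrt{7}}+2\sqrt{3}=3.57321\ldots.$$ *)

theory Defs
  imports "HOL-Analysis.Analysis"
begin

definition taylor_coeff0 :: "(complex \<Rightarrow> complex) \<Rightarrow> nat \<Rightarrow> complex" where
  "taylor_coeff0 h n = (deriv ^^ n) h 0 / fact n"

end

theory Submission
  imports Defs "HOL-Complex_Analysis.Complex_Analysis"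
begin

text \<open>
  Put \<open>p(z) = z / f(z) = 1 + p\<^sub>2 z\<^sup>2 + p\<^sub>3 z\<^sup>3 + p\<^sub>4 z\<^sup>4 + \<dots>\<close>. The inverse \<open>g\<close> of \<open>f\<close> satisfies
  \<open>g(w) = w p(g(w))\<close>, whence \<open>A\<^sub>3 = p\<^sub>2\<close>, \<open>A\<^sub>4 = p\<^sub>3\<close>, \<open>A\<^sub>5 = 2 p\<^sub>2\<^sup>2 + p\<^sub>4\<close>, and the determinant is
  \<open>2 p\<^sub>2\<^sup>3 + p\<^sub>2 p\<^sub>4 - p\<^sub>3\<^sup>2\<close>. Gronwall's area theorem for \<open>1 / f\<close> gives
  \<open>|p\<^sub>2|\<^sup>2 + 2 |p\<^sub>3|\<^sup>2 + 3 |p\<^sub>4|\<^sup>2 \<le> 1\<close>, so the determinant is at most \<open>2 + 1/2\<close> in modulus, which is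
  below the claimed bound.

  The area theorem is obtained without Green's theorem. On the circle \<open>|z| = \<epsilon>\<close> the map \<open>p(z) / z\<close>
  is \<open>1/z + p\<^sub>2 z + O(\<epsilon>\<^sup>2)\<close>, so this circle is sent close to an ellipse, and the real-linear map
  \<open>w \<mapsto> w - p\<^sub>2 \<epsilon>\<^sup>2 cnj w\<close> turns the ellipse into a circle. Thus the image of the annulus
  \<open>\<epsilon> < |z| < \<rho>\<close> lies in a disc of radius \<open>1/\<epsilon> + O(\<epsilon>\<^sup>2)\<close> after this map, while its area is computed
  in logarithmic coordinates \<open>z = exp u\<close> by change of variables and bounded below by Bessel's
  inequality. Let \<open>\<epsilon> \<rightarrow> 0\<close> and then \<open>\<rho> \<rightarrow> 1\<close>.
\<close>

section \<open>Taylor coefficients: Cauchy integrals, Bessel's inequality on circles, remainder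
  bound\<close>

lemma has_fps_expansion_taylor_coeff0:
  assumes "h has_fps_expansion H"
  shows "taylor_coeff0 h n = fps_nth H n"
  using fps_nth_fps_expansion[OF assms] by (simp add: taylor_coeff0_def)

text \<open>Cauchy's formula for the \<open>k\<close>-th derivative on the circle of radius
  \<open>s\<close>, where \<open>1 / z ^ k\<close> equals
  \<open>cnj (z ^ k) / s ^ (2 * k)\<close>.\<close>

lemma circle_fourier_coefficient:
  assumes hol: "h holomorphic_on ball 0 R" and s: "0 < s" "s < R"
  shows "((\<lambda>\<theta>. cnj ((s * cis \<theta>) ^ k) * h (s * cis \<theta>))
           has_integral of_real (2 * pi * s ^ (2 * k)) * taylor_coeff0 h k) {0..2 * pi}"
proof -
  have "continuous_on (cball 0 s) h" "h holomorphic_on ball 0 s"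
    using s by (auto intro!: holomorphic_on_imp_continuous_on holomorphic_on_subset[OF hol])
  then have "((\<lambda>u. h u / (u - 0) ^ Suc k) has_contour_integral
      ((2 * pi * \<i>) / (fact k) * (deriv ^^ k) h 0)) (circlepath 0 s)"
    using s by (intro Cauchy_has_contour_integral_higher_derivative_circlepath) auto
  then have "((\<lambda>\<theta>. h (s * cis \<theta>) / (s * cis \<theta>) ^ Suc k * s * \<i> * cis \<theta>) has_integral
      ((2 * pi * \<i>) / (fact k) * (deriv ^^ k) h 0)) {0..2 * pi}"
    unfolding circlepath_def
    by (subst (asm) has_contour_integral_part_circlepath_iff) auto
  from has_integral_mult_right[OF this, of "of_real (s ^ (2 * k)) / \<i>"]
  have I: "((\<lambda>\<theta>. of_real (s ^ (2 * k)) / \<i> * (h (s * cis \<theta>) / (s * cis \<theta>) ^ Suc k * s * \<i> * cis \<theta>))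
      has_integral (of_real (s ^ (2 * k)) / \<i> * ((2 * pi * \<i>) / (fact k) * (deriv ^^ k) h 0))) {0..2 * pi}" .
  have E: "of_real (s ^ (2 * k)) / \<i> * (h (s * cis \<theta>) / (s * cis \<theta>) ^ Suc k * s * \<i> * cis \<theta>)
      = cnj ((s * cis \<theta>) ^ k) * h (s * cis \<theta>)" for \<theta>
  proof -
    have "of_real (s ^ (2 * k)) = cnj ((s * cis \<theta>) ^ k) * (s * cis \<theta>) ^ k"
    proof -
      have "cnj ((s * cis \<theta>) ^ k) * (s * cis \<theta>) ^ k = (cnj (s * cis \<theta>) * (s * cis \<theta>)) ^ k"
        by (simp add: power_mult_distrib)
      also have "cnj (s * cis \<theta>) * (s * cis \<theta>) = of_real (s\<^sup>2)"
        by (simp add: complex_norm_square[symmetric] mult.commute norm_mult flip: of_real_power)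
           (metis (no_types, lifting) complex_norm_square mult.commute norm_mult norm_cis norm_of_real
              mult.right_neutral power2_abs of_real_power complex_cnj_mult complex_cnj_complex_of_real cis_cnj)
      finally show ?thesis by (simp add: power_mult)
    qed
    with s show ?thesis by (simp add: field_simps)
  qed
  show ?thesis
    using I unfolding E by (simp add: taylor_coeff0_def mult_ac)
qed

lemma taylor_coeff0_polynomial:
  assumes "k \<le> N"
  shows "taylor_coeff0 (\<lambda>z. \<Sum>j\<le>N. c j * z ^ j) k = c k"
proof -
  have "(\<lambda>z. \<Sum>j\<le>N. c j * z ^ j) has_fps_expansion (\<Sum>j\<le>N. fps_const (c j) * fps_X ^ j)"
    by (intro fps_expansion_intros)
  from has_fps_expansion_taylor_coeff0[OF this] show ?thesis
    using assms by (simp add: fps_sum_nth if_distrib[of "\<lambda>x. _ * x"] cong: if_cong)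
qed

text \<open>With \<open>P\<close> the Taylor polynomial of degree \<open>N\<close>, integrate the
  square of \<open>cmod (P - h)\<close>, which is nonnegative. A finite sum suffices later, so no
  series has to be integrated termwise.\<close>

lemma circle_bessel_inequality:
  assumes hol: "h holomorphic_on ball 0 R" and s: "0 < s" "s < R"
  shows "2 * pi * (\<Sum>k\<le>N. (cmod (taylor_coeff0 h k))\<^sup>2 * s ^ (2 * k))
          \<le> integral {0..2 * pi} (\<lambda>\<theta>. (cmod (h (s * cis \<theta>)))\<^sup>2)"
proof -
  define c where "c = taylor_coeff0 h"
  define P where "P z = (\<Sum>k\<le>N. c k * z ^ k)" for z
  define A where "A = 2 * pi * (\<Sum>k\<le>N. (cmod (c k))\<^sup>2 * s ^ (2 * k))"
  \<comment> \<open>Pairing with \<open>P\<close> sees only the coefficients up to \<open>N\<close>,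
    so \<open>g = P\<close> and \<open>g = h\<close> give the same value \<open>A\<close>.\<close>
  have projection: "((\<lambda>\<theta>. cnj (P (s * cis \<theta>)) * g (s * cis \<theta>)) has_integral of_real A) {0..2 * pi}"
    if "g holomorphic_on ball 0 R" "\<And>k. k \<le> N \<Longrightarrow> taylor_coeff0 g k = c k" for g
  proof -
    have "((\<lambda>\<theta>. \<Sum>k\<le>N. cnj (c k) * (cnj ((s * cis \<theta>) ^ k) * g (s * cis \<theta>))) has_integral
        (\<Sum>k\<le>N. cnj (c k) * (of_real (2 * pi * s ^ (2 * k)) * taylor_coeff0 g k))) {0..2 * pi}"
      by (intro has_integral_sum has_integral_mult_right circle_fourier_coefficient[where R = R] that s) auto
    moreover have "(\<Sum>k\<le>N. cnj (c k) * (of_real (2 * pi * s ^ (2 * k)) * taylor_coeff0 g k)) = of_real A"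
      unfolding A_def sum_distrib_left of_real_sum
    proof (rule sum.cong)
      fix k assume "k \<in> {..N}"
      then show "cnj (c k) * (of_real (2 * pi * s ^ (2 * k)) * taylor_coeff0 g k)
          = of_real (2 * pi * ((cmod (c k))\<^sup>2 * s ^ (2 * k)))"
        using that(2)[of k] complex_norm_square[of "c k"] by (simp add: mult_ac)
    qed simp
    ultimately show ?thesis
      by (simp add: P_def sum_distrib_right mult.assoc)
  qed
  have "P holomorphic_on ball 0 R" unfolding P_def by (intro holomorphic_intros)
  then have IP: "((\<lambda>\<theta>. Re (cnj (P (s * cis \<theta>)) * P (s * cis \<theta>))) has_integral A) {0..2 * pi}"
    using has_integral_Re[OF projection[of P]] by (simp add: P_def[abs_def] taylor_coeff0_polynomial)
  have Ih: "((\<lambda>\<theta>. Re (cnj (P (s * cis \<theta>)) * h (s * cis \<theta>))) has_integral A) {0..2 * pi}"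
    using has_integral_Re[OF projection[of h]] hol by (simp add: c_def)
  have "((\<lambda>\<theta>. 2 * Re (cnj (P (s * cis \<theta>)) * h (s * cis \<theta>)) - Re (cnj (P (s * cis \<theta>)) * P (s * cis \<theta>)))
      has_integral (2 * A - A)) {0..2 * pi}"
    by (intro has_integral_diff has_integral_mult_right IP Ih)
  moreover have "(\<lambda>\<theta>. (cmod (h (s * cis \<theta>)))\<^sup>2) integrable_on {0..2 * pi}"
    by (intro integrable_continuous_interval continuous_intros
          continuous_on_compose2[OF holomorphic_on_imp_continuous_on[OF hol]])
       (use s in \<open>auto simp: norm_mult\<close>)
  moreover have "2 * Re (cnj u * v) - Re (cnj u * u) \<le> (cmod v)\<^sup>2" for u v
  proof -
    have "(cmod v)\<^sup>2 - (2 * Re (cnj u * v) - Re (cnj u * u)) = (cmod (u - v))\<^sup>2"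
      unfolding cmod_power2 by (simp add: algebra_simps power2_eq_square)
    then show ?thesis by (metis diff_ge_0_iff_ge zero_le_power2)
  qed
  ultimately have "2 * A - A \<le> integral {0..2 * pi} (\<lambda>\<theta>. (cmod (h (s * cis \<theta>)))\<^sup>2)"
    by (intro has_integral_le[OF _ integrable_integral]) auto
  then show ?thesis by (simp add: A_def c_def)
qed

text \<open>The remainder is \<open>z ^ n\<close> times the shifted power series, which is
  continuous on the compact disc of radius \<rho> and hence bounded there.\<close>

lemma holomorphic_taylor_remainder_bound:
  assumes hol: "h holomorphic_on ball 0 R" and "\<rho> < R"
  obtains M where "M \<ge> 0"
    "\<And>z. cmod z \<le> \<rho> \<Longrightarrow> cmod (h z - (\<Sum>k<n. taylor_coeff0 h k * z ^ k)) \<le> M * cmod z ^ n"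
proof (cases "R > 0")
  case True
  define H where "H = fps_expansion h 0"
  have exp: "h has_fps_expansion H" unfolding H_def
    by (rule has_fps_expansion_fps_expansion[OF _ _ hol]) (use True in auto)
  have rad: "fps_conv_radius H \<ge> ereal R" unfolding H_def
    by (rule conv_radius_fps_expansion) (use hol in auto)
  have H: "eval_fps H z = h z" if "z \<in> ball 0 R" for z
    unfolding H_def using eval_fps_expansion'[of h 0 "ereal R" z] hol that by simp
  have in_disc: "ereal (cmod z) < fps_conv_radius H" if "cmod z \<le> \<rho>" for z
  proof -
    have "ereal (cmod z) < ereal R" using that assms(2) by simp
    also note rad
    finally show ?thesis .
  qed
  have "continuous_on (cball 0 \<rho>) (eval_fps (fps_shift n H))"
    by (intro continuous_on_eval_fps' continuous_on_id) (auto simp: in_disc)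
  then have "bounded (eval_fps (fps_shift n H) ` cball 0 \<rho>)"
    by (intro compact_imp_bounded compact_continuous_image) auto
  then obtain M where M: "\<And>z. z \<in> cball 0 \<rho> \<Longrightarrow> cmod (eval_fps (fps_shift n H) z) \<le> M"
    unfolding bounded_iff by blast
  show ?thesis
  proof
    show "max M 0 \<ge> 0" by simp
    fix z :: complex assume z: "cmod z \<le> \<rho>"
    then have zR: "z \<in> ball 0 R" using assms by simp
    have "summable (\<lambda>k. fps_nth H k * z ^ k)"
      by (rule summable_fps) (rule in_disc[OF z])
    then have "h z = (\<Sum>k. fps_nth H (k + n) * z ^ (k + n)) + (\<Sum>k<n. fps_nth H k * z ^ k)"
      using suminf_split_initial_segment[of "\<lambda>k. fps_nth H k * z ^ k" n] H[OF zR] by (simp add: eval_fps_def)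
    also have "(\<Sum>k. fps_nth H (k + n) * z ^ (k + n)) = z ^ n * eval_fps (fps_shift n H) z"
    proof -
      have "summable (\<lambda>k. fps_nth (fps_shift n H) k * z ^ k)"
        by (rule summable_fps) (use in_disc[OF z] in simp)
      from suminf_mult[OF this, of "z ^ n"] show ?thesis
        by (simp add: eval_fps_def power_add mult_ac)
    qed
    finally have "cmod (h z - (\<Sum>k<n. taylor_coeff0 h k * z ^ k)) = cmod (eval_fps (fps_shift n H) z) * cmod z ^ n"
      by (simp add: has_fps_expansion_taylor_coeff0[OF exp] norm_mult norm_power)
    also have "\<dots> \<le> max M 0 * cmod z ^ n"
      using M[of z] z by (intro mult_right_mono) auto
    finally show "cmod (h z - (\<Sum>k<n. taylor_coeff0 h k * z ^ k)) \<le> max M 0 * cmod z ^ n" .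
  qed
next
  \<comment> \<open>Here \<rho> is negative, so the bound is vacuous and \<open>M = 0\<close>
    serves.\<close>
  case False
  then have "\<not> cmod z \<le> \<rho>" for z using assms(2) norm_ge_zero[of z] by linarith
  then show ?thesis using that[of 0] by auto
qed

section \<open>Transfer between the complex plane and \<open>real^2\<close>; area and iterated
  integrals\<close>

definition vec_of_complex :: "complex \<Rightarrow> real^2" where
  "vec_of_complex w = vector [Re w, Im w]"

text \<open>The change of variables for areas below is carried out on \<open>real^2\<close>, with
  the Jacobian as a matrix determinant; planar maps are conjugated by this pair of
  isometries.\<close>

definition complex_of_vec :: "real^2 \<Rightarrow> complex" where
  "complex_of_vec x = Complex (x $ 1) (x $ 2)"

lemma complex_of_vec_of_complex [simp]: "complex_of_vec (vec_of_complex w) = w"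
  by (simp add: vec_of_complex_def complex_of_vec_def)

lemma vec_of_complex_of_vec [simp]: "vec_of_complex (complex_of_vec x) = x"
  by (simp add: vec_of_complex_def complex_of_vec_def vec_eq_iff forall_2)

lemma norm_vec_of_complex [simp]: "norm (vec_of_complex w) = cmod w"
  by (simp add: norm_vec_def L2_set_def sum_2 vec_of_complex_def cmod_def)

lemma bounded_linear_vec_of_complex: "bounded_linear vec_of_complex"
proof (rule bounded_linear_intro[where K = 1])
  fix x y r
  show "vec_of_complex (x + y) = vec_of_complex x + vec_of_complex y"
    "vec_of_complex (r *\<^sub>R x) = r *\<^sub>R vec_of_complex x"
    by (simp_all add: vec_of_complex_def vec_eq_iff forall_2)
qed simp

lemma bounded_linear_complex_of_vec: "bounded_linear complex_of_vec"
proof (rule bounded_linear_intro[where K = 1])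
  fix x y r
  show "complex_of_vec (x + y) = complex_of_vec x + complex_of_vec y"
    "complex_of_vec (r *\<^sub>R x) = r *\<^sub>R complex_of_vec x"
    by (simp_all add: complex_of_vec_def complex_eq_iff)
  show "norm (complex_of_vec x) \<le> norm x * 1"
    using norm_vec_of_complex[of "complex_of_vec x"] by simp
qed

text \<open>The Jacobian in Wirtinger form: \<open>a\<close> is the complex-linear part and
  \<open>b\<close> the conjugate-linear part.\<close>

lemma det_matrix_complex_real_linear:
  "det (matrix (\<lambda>x. vec_of_complex (a * complex_of_vec x + b * cnj (complex_of_vec x))))
     = (cmod a)\<^sup>2 - (cmod b)\<^sup>2"
  by (simp add: det_2 matrix_def vec_of_complex_def complex_of_vec_def axis_def cmod_power2)
     (simp add: algebra_simps power2_eq_square)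

text \<open>Fubini's theorem holds on \<open>real \<times> real\<close>; the coordinate bijection to
  \<open>real^2\<close> maps boxes to boxes of equal content and so carries the integral
  over.\<close>

lemma has_integral_vec2_iterated:
  fixes g :: "real \<Rightarrow> real \<Rightarrow> real"
  assumes cont: "continuous_on (cbox (a, c) (b, d)) (\<lambda>(x, y). g x y)"
  shows "((\<lambda>v. g (v $ 1) (v $ 2)) has_integral
           integral {a..b} (\<lambda>x. integral {c..d} (g x))) (cbox (vector [a, c]) (vector [b, d] :: real^2))"
proof -
  define \<phi> where "\<phi> v = (v $ 1, v $ 2)" for v :: "real^2"
  define \<psi> where "\<psi> p = (vector [fst p, snd p] :: real^2)" for p :: "real \<times> real"
  have cb1: "\<phi> ` cbox u v = cbox (u $ 1, u $ 2) (v $ 1, v $ 2)" for u v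
  proof (intro set_eqI iffI)
    fix p assume p: "p \<in> cbox (u $ 1, u $ 2) (v $ 1, v $ 2)"
    then have "\<psi> p \<in> cbox u v" "\<phi> (\<psi> p) = p"
      by (auto simp: \<phi>_def \<psi>_def mem_box_cart forall_2 cbox_Pair_eq)
    then show "p \<in> \<phi> ` cbox u v" by (metis image_eqI)
  qed (auto simp: \<phi>_def mem_box_cart cbox_Pair_eq)
  have cb2: "\<psi> ` cbox (a, c) (b, d) = cbox (vector [a, c]) (vector [b, d])" for a b c d
  proof (intro set_eqI iffI)
    fix v :: "real^2" assume v: "v \<in> cbox (vector [a, c]) (vector [b, d])"
    then have "\<phi> v \<in> cbox (a, c) (b, d)" "\<psi> (\<phi> v) = v"
      by (auto simp: \<phi>_def \<psi>_def mem_box_cart forall_2 cbox_Pair_eq vec_eq_iff)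
    then show "v \<in> \<psi> ` cbox (a, c) (b, d)" by (metis image_eqI)
  qed (auto simp: \<psi>_def mem_box_cart cbox_Pair_eq forall_2)
  have "((\<lambda>(x, y). g x y) has_integral integral (cbox (a, c) (b, d)) (\<lambda>(x, y). g x y)) (cbox (a, c) (b, d))"
    by (intro integrable_integral integrable_continuous cont)
  also have "integral (cbox (a, c) (b, d)) (\<lambda>(x, y). g x y) = integral {a..b} (\<lambda>x. integral {c..d} (g x))"
    using integral_prod_continuous[OF cont] by simp
  finally have "((\<lambda>v. (\<lambda>(x, y). g x y) (\<phi> v)) has_integral
      (1 / 1) *\<^sub>R integral {a..b} (\<lambda>x. integral {c..d} (g x))) (\<psi> ` cbox (a, c) (b, d))"
  proof (rule has_integral_twiddle[rotated -1])
    show "continuous (at x) \<phi>" for x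
      unfolding \<phi>_def by (intro continuous_intros)
    show "measure lborel (\<phi> ` cbox u v) = 1 * measure lborel (cbox u v)" for u v
    proof (cases "u $ 1 \<le> v $ 1 \<and> u $ 2 \<le> v $ 2")
      case True
      then have "cbox u v \<noteq> {}" by (simp add: interval_ne_empty_cart forall_2)
      with True show ?thesis by (simp add: cb1 content_Pair content_cbox_cart UNIV_2)
    next
      case False
      then have "cbox u v = {}" by (auto simp: interval_eq_empty_cart not_le)
      then show ?thesis by simp
    qed
  next
    show "\<exists>w z. \<phi> ` cbox u v = cbox w z" for u v using cb1 by blast
    show "\<exists>w z. \<psi> ` cbox u v = cbox w z" for u v using cb2 by (cases u, cases v) blast
  qed (auto simp: \<phi>_def \<psi>_def vec_eq_iff forall_2)
  then show ?thesis by (simp add: cb2 \<phi>_def)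
qed

lemma measure_le_of_subset_cball_vec2:
  fixes S :: "(real^2) set"
  assumes "S \<in> lmeasurable" "S \<subseteq> cball 0 T" "T \<ge> 0"
  shows "measure lebesgue S \<le> pi * T\<^sup>2"
proof -
  have "measure lebesgue S \<le> measure lebesgue (cball (0 :: real^2) T)"
    by (rule measure_mono_fmeasurable) (use assms in auto)
  also have "\<dots> = pi * T\<^sup>2"
    using assms(3) by (simp add: content_cball unit_ball_vol_2)
  finally show ?thesis .
qed

section \<open>Area estimates and Gronwall's area theorem\<close>

lemma taylor_coeff0_z_deriv_minus:
  assumes "p holomorphic_on ball 0 R" "R > 0"
  shows "taylor_coeff0 (\<lambda>z. z * deriv p z - p z) k = (of_nat k - 1) * taylor_coeff0 p k"
proof -
  have P: "p has_fps_expansion fps_expansion p 0"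
    by (rule has_fps_expansion_fps_expansion[OF _ _ assms(1)]) (use assms in auto)
  have "(\<lambda>z. z * deriv p z - p z) has_fps_expansion
      fps_X * fps_deriv (fps_expansion p 0) - fps_expansion p 0"
    by (intro fps_expansion_intros P)
  from has_fps_expansion_taylor_coeff0[OF this, of k] has_fps_expansion_taylor_coeff0[OF P, of k]
  show ?thesis by (cases k) (simp_all add: algebra_simps)
qed

text \<open>The area of the image of the annulus is at most that of the disc of radius
  \<open>T\<close>, and at least what Bessel's inequality gives for the integrated Jacobian; a
  common factor \<open>pi\<close> cancels. The term \<open>k = 0\<close> is nonnegative too, both of
  its factors being at most 0.\<close>

lemma annulus_image_area_inequality:
  fixes p :: "complex \<Rightarrow> complex" and \<beta> :: complex
  assumes hol: "p holomorphic_on ball 0 1"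
    and inj: "inj_on (\<lambda>z. p z / z) (ball 0 1 - {0})"
    and ab: "a \<le> b" "b < 0" and \<beta>: "cmod \<beta> < 1" and T: "T \<ge> 0"
    and bound: "\<And>z. exp a \<le> cmod z \<Longrightarrow> cmod z \<le> exp b \<Longrightarrow> cmod (p z / z - \<beta> * cnj (p z / z)) \<le> T"
  shows "(1 - (cmod \<beta>)\<^sup>2) * (\<Sum>k\<le>N. (real k - 1) * (cmod (taylor_coeff0 p k))\<^sup>2 *
            (exp (2 * (real k - 1) * b) - exp (2 * (real k - 1) * a))) \<le> T\<^sup>2"
proof -
  define F where "F z = p z / z" for z
  \<comment> \<open>\<open>h z / z\<^sup>2\<close> is the derivative of \<open>F\<close>, so
    \<open>u \<mapsto> F (exp u)\<close> has derivative \<open>h z / z\<close> at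
    \<open>z = exp u\<close>. With \<open>cmod z = exp t\<close> this explains the factor
    \<open>exp (- 2 * t)\<close> in \<open>J\<close>.\<close>
  define h where "h z = z * deriv p z - p z" for z
  define J where "J t \<theta> = (1 - (cmod \<beta>)\<^sup>2) * exp (- 2 * t) * (cmod (h (of_real (exp t) * cis \<theta>)))\<^sup>2" for t \<theta>
  define \<Psi> where "\<Psi> x = vec_of_complex (F (exp (complex_of_vec x)) - \<beta> * cnj (F (exp (complex_of_vec x))))"
    for x
  \<comment> \<open>The angle stays strictly between 0 and \<open>2 * pi\<close>, which makes
    \<open>exp\<close> injective on the rectangle.\<close>
  define S where "S = box (vector [a, 0]) (vector [b, 2 * pi] :: real^2)"
  define c where "c x = h (exp (complex_of_vec x)) / exp (complex_of_vec x)" for x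
  define \<Psi>' where "\<Psi>' x v = vec_of_complex (c x * complex_of_vec v + (- \<beta> * cnj (c x)) * cnj (complex_of_vec v))"
    for x v
  have \<beta>2: "(cmod \<beta>)\<^sup>2 < 1" using \<beta> by (simp add: power_less_one_iff)
  have hol_h: "h holomorphic_on ball 0 1"
    unfolding h_def by (intro holomorphic_intros hol holomorphic_deriv) auto
  have S: "a < x $ 1" "x $ 1 < b" "0 < x $ 2" "x $ 2 < 2 * pi" if "x \<in> S" for x :: "real^2"
    using that by (auto simp: S_def mem_box_cart forall_2)
  have exp_vec: "exp (complex_of_vec x) = of_real (exp (x $ 1)) * cis (x $ 2)" for x :: "real^2"
    by (simp add: exp_eq_polar complex_of_vec_def)
  have exp_in: "exp (complex_of_vec x) \<in> ball 0 1 - {0}" if "x \<in> S" for x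
    using S[OF that] ab by (simp add: exp_vec norm_mult)
  have der: "(\<Psi> has_derivative \<Psi>' x) (at x within S)" if x: "x \<in> S" for x
  proof -
    define z where "z = exp (complex_of_vec x)"
    have z: "z \<in> ball 0 1" "z \<noteq> 0" using exp_in[OF x] by (auto simp: z_def)
    have "(p has_field_derivative deriv p z) (at z)"
      by (rule holomorphic_derivI[OF hol]) (use z in auto)
    then have "(F has_field_derivative h z / z\<^sup>2) (at z)"
      unfolding F_def[abs_def] h_def using z
      by (auto intro!: derivative_eq_intros simp: field_simps power2_eq_square)
    then have "((\<lambda>u. F (exp u)) has_field_derivative h z / z\<^sup>2 * exp (complex_of_vec x)) (at (complex_of_vec x))"
      unfolding z_def by (intro DERIV_chain2[where f = F] DERIV_exp)
    moreover have "h z / z\<^sup>2 * exp (complex_of_vec x) = c x"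
      using z by (simp add: z_def[symmetric] c_def power2_eq_square)
    ultimately have "((\<lambda>u. F (exp u)) has_derivative (*) (c x)) (at (complex_of_vec x))"
      by (simp add: has_field_derivative_def)
    then have "((\<lambda>x. F (exp (complex_of_vec x))) has_derivative (\<lambda>v. c x * complex_of_vec v)) (at x within S)"
      using has_derivative_compose[OF bounded_linear_imp_has_derivative[OF bounded_linear_complex_of_vec]]
      by blast
    then have "(\<Psi> has_derivative (\<lambda>v. vec_of_complex (c x * complex_of_vec v - \<beta> * cnj (c x * complex_of_vec v))))
        (at x within S)"
      unfolding \<Psi>_def
      by (intro bounded_linear.has_derivative[OF bounded_linear_vec_of_complex] has_derivative_diff
            has_derivative_mult_right bounded_linear.has_derivative[OF bounded_linear_cnj])
    then show ?thesis by (simp add: \<Psi>'_def[abs_def] mult.assoc)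
  qed
  have det: "\<bar>det (matrix (\<Psi>' x))\<bar> = J (x $ 1) (x $ 2)" for x
  proof -
    have "det (matrix (\<Psi>' x)) = (cmod (c x))\<^sup>2 - (cmod (- \<beta> * cnj (c x)))\<^sup>2"
      unfolding \<Psi>'_def[abs_def] by (rule det_matrix_complex_real_linear)
    also have "\<dots> = (1 - (cmod \<beta>)\<^sup>2) * (cmod (c x))\<^sup>2"
      by (simp add: norm_mult power_mult_distrib algebra_simps)
    also have "\<dots> = J (x $ 1) (x $ 2)"
      by (simp add: c_def J_def exp_vec norm_divide norm_mult power_divide exp_minus field_simps
          flip: exp_of_nat_mult)
    finally have "det (matrix (\<Psi>' x)) = J (x $ 1) (x $ 2)" .
    moreover have "J (x $ 1) (x $ 2) \<ge> 0" using \<beta>2 by (simp add: J_def)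
    ultimately show ?thesis by simp
  qed
  have inj_\<Psi>: "inj_on \<Psi> S"
  proof (rule inj_onI)
    fix x y assume x: "x \<in> S" and y: "y \<in> S" and "\<Psi> x = \<Psi> y"
    define u where "u = F (exp (complex_of_vec x)) - F (exp (complex_of_vec y))"
    have "complex_of_vec (\<Psi> x) = complex_of_vec (\<Psi> y)" using \<open>\<Psi> x = \<Psi> y\<close> by simp
    then have "u = \<beta> * cnj u" by (simp add: \<Psi>_def u_def algebra_simps)
    \<comment> \<open>Since \<open>cmod \<beta> < 1\<close>, the map
      \<open>w \<mapsto> w - \<beta> * cnj w\<close> has trivial kernel.\<close>
    then have "cmod u = cmod \<beta> * cmod u" by (metis norm_mult complex_mod_cnj)
    with \<beta> have "u = 0" by simp
    then have exp_eq: "exp (complex_of_vec x) = exp (complex_of_vec y)"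
      using inj_onD[OF inj, of "exp (complex_of_vec x)" "exp (complex_of_vec y)"] exp_in[OF x] exp_in[OF y]
      by (simp add: u_def F_def)
    have "\<bar>Im (complex_of_vec x) - Im (complex_of_vec y)\<bar> < 2 * pi"
      using S(3,4)[OF x] S(3,4)[OF y] unfolding complex_of_vec_def complex.sel by linarith
    then have "complex_of_vec x = complex_of_vec y"
      by (rule exp_complex_eqI[OF _ exp_eq])
    then have "vec_of_complex (complex_of_vec x) = vec_of_complex (complex_of_vec y)" by (rule arg_cong)
    then show "x = y" by (simp only: vec_of_complex_of_vec)
  qed
  have contJ: "continuous_on (cbox (a, 0) (b, 2 * pi)) (\<lambda>(t, \<theta>). J t \<theta>)"
    unfolding J_def case_prod_beta
    by (intro continuous_intros continuous_on_compose2[OF holomorphic_on_imp_continuous_on[OF hol_h]])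
       (use ab in \<open>auto simp: norm_mult cbox_Pair_eq\<close>)
  define m where "m = integral {a..b} (\<lambda>t. integral {0..2 * pi} (J t))"
  have "((\<lambda>x. \<bar>det (matrix (\<Psi>' x))\<bar>) has_integral m) S"
    unfolding det S_def m_def has_integral_open_interval
    by (rule has_integral_vec2_iterated[OF contJ])
  then have "\<Psi> ` S \<in> lmeasurable \<and> measure lebesgue (\<Psi> ` S) = m"
    using has_measure_differentiable_image[OF _ der inj_\<Psi>] by (auto simp: S_def)
  moreover have "\<Psi> ` S \<subseteq> cball 0 T"
  proof safe
    fix x assume x: "x \<in> S"
    have "cmod (F (exp (complex_of_vec x)) - \<beta> * cnj (F (exp (complex_of_vec x)))) \<le> T"
      unfolding F_def by (rule bound) (use S[OF x] in \<open>auto simp: complex_of_vec_def\<close>)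
    then show "\<Psi> x \<in> cball 0 T" by (simp add: \<Psi>_def)
  qed
  ultimately have "m \<le> pi * T\<^sup>2"
    using measure_le_of_subset_cball_vec2[of "\<Psi> ` S" T] T by simp
  \<comment> \<open>\<open>B'\<close> is the Bessel lower bound for the angular integral of
    \<open>J\<close>, and \<open>B\<close> is an antiderivative of it: differentiating the
    exponential supplies the second factor \<open>k - 1\<close> needed to form the coefficients of
    \<open>h\<close>.\<close>
  define B where "B t = (1 - (cmod \<beta>)\<^sup>2) * pi * (\<Sum>k\<le>N. (real k - 1) * (cmod (taylor_coeff0 p k))\<^sup>2 * exp (2 * (real k - 1) * t))" for t
  define B' where "B' t = (1 - (cmod \<beta>)\<^sup>2) * exp (- 2 * t) * (2 * pi * (\<Sum>k\<le>N. (cmod (taylor_coeff0 h k))\<^sup>2 * exp t ^ (2 * k)))" for t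
  have h_coeff: "(cmod (taylor_coeff0 h k))\<^sup>2 = (real k - 1)\<^sup>2 * (cmod (taylor_coeff0 p k))\<^sup>2" for k
  proof -
    have "taylor_coeff0 h k = of_real (real k - 1) * taylor_coeff0 p k"
      unfolding h_def using taylor_coeff0_z_deriv_minus[OF hol] by simp
    then show ?thesis by (simp only: norm_mult norm_of_real power_mult_distrib power2_abs)
  qed
  have "(B has_vector_derivative B' t) (at t within {a..b})" for t
  proof -
    have "(B has_real_derivative (1 - (cmod \<beta>)\<^sup>2) * pi * (\<Sum>k\<le>N. (real k - 1) * (cmod (taylor_coeff0 p k))\<^sup>2 *
        (exp (2 * (real k - 1) * t) * (2 * (real k - 1))))) (at t within {a..b})"
      unfolding B_def by (intro DERIV_cmult DERIV_sum) (auto intro!: derivative_eq_intros)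
    also have "(1 - (cmod \<beta>)\<^sup>2) * pi * (\<Sum>k\<le>N. (real k - 1) * (cmod (taylor_coeff0 p k))\<^sup>2 *
        (exp (2 * (real k - 1) * t) * (2 * (real k - 1)))) = B' t"
    proof -
      have "(real k - 1) * (cmod (taylor_coeff0 p k))\<^sup>2 * (exp (2 * (real k - 1) * t) * (2 * (real k - 1)))
          = 2 * exp (- 2 * t) * ((cmod (taylor_coeff0 h k))\<^sup>2 * exp t ^ (2 * k))" for k
      proof -
        have exp_split: "exp (2 * (real k - 1) * t) = exp (- 2 * t) * exp t ^ (2 * k)"
          by (simp add: exp_of_nat_mult[symmetric] mult_exp_exp algebra_simps)
        show ?thesis unfolding exp_split h_coeff by (simp only: power2_eq_square mult_ac)
      qed
      then show ?thesis by (simp add: B'_def sum_distrib_left[symmetric] mult_ac)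
    qed
    finally show ?thesis by (simp add: has_real_derivative_iff_has_vector_derivative)
  qed
  then have "(B' has_integral (B b - B a)) {a..b}"
    by (intro fundamental_theorem_of_calculus ab)
  moreover have "(\<lambda>t. integral {0..2 * pi} (J t)) integrable_on {a..b}"
    using integral_integrable_2dim[OF contJ] by simp
  moreover have "B' t \<le> integral {0..2 * pi} (J t)" if "t \<in> {a..b}" for t
    unfolding B'_def J_def integral_mult_right
    using circle_bessel_inequality[OF hol_h, of "exp t" N] that ab \<beta>2
    by (intro mult_left_mono) auto
  ultimately have "B b - B a \<le> m"
    unfolding m_def by (rule has_integral_le[OF _ integrable_integral])
  with \<open>m \<le> pi * T\<^sup>2\<close> have "B b - B a \<le> pi * T\<^sup>2" by simp
  also have "B b - B a = pi * ((1 - (cmod \<beta>)\<^sup>2) * (\<Sum>k\<le>N. (real k - 1) * (cmod (taylor_coeff0 p k))\<^sup>2 *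
            (exp (2 * (real k - 1) * b) - exp (2 * (real k - 1) * a))))"
    by (simp add: B_def sum_subtractf sum.distrib algebra_simps)
  finally show ?thesis by simp
qed

text \<open>Write \<open>s = cmod z\<close>. At \<open>s = \<epsilon>\<close> the terms
  \<open>p2 * z\<close> and \<open>\<beta> * (1 / cnj z)\<close> cancel, leaving
  \<open>1 / z\<close> and an error of order \<open>\<epsilon>\<^sup>2\<close>. For larger
  \<open>s\<close> the error grows by at most a multiple of \<open>s - \<epsilon>\<close>, which the
  decrease of \<open>1 / s\<close> absorbs; so the bound holds on the whole annulus.\<close>

lemma image_of_annulus_in_near_ellipse:
  fixes p :: "complex \<Rightarrow> complex"
  assumes hol: "p holomorphic_on ball 0 1" and p0: "p 0 = 1" and p1: "taylor_coeff0 p 1 = 0"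
    and "\<rho> < 1"
  obtains C \<epsilon>\<^sub>0 where "C \<ge> 0" "\<epsilon>\<^sub>0 > 0"
    "\<And>\<epsilon> z. \<lbrakk>0 < \<epsilon>; \<epsilon> < \<epsilon>\<^sub>0; \<epsilon> \<le> cmod z; cmod z \<le> \<rho>\<rbrakk> \<Longrightarrow>
       cmod (p z / z - (taylor_coeff0 p 2 * of_real (\<epsilon>\<^sup>2)) * cnj (p z / z)) \<le> 1 / \<epsilon> + C * \<epsilon>\<^sup>2"
proof -
  obtain M where M: "M \<ge> 0"
    "\<And>z. cmod z \<le> \<rho> \<Longrightarrow> cmod (p z - (\<Sum>k<3. taylor_coeff0 p k * z ^ k)) \<le> M * cmod z ^ 3"
    using holomorphic_taylor_remainder_bound[OF hol \<open>\<rho> < 1\<close>, of 3] by blast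
  define p2 where "p2 = taylor_coeff0 p 2"
  define a where "a = cmod p2"
  have a: "a \<ge> 0" by (simp add: a_def)
  have "(\<Sum>k<3. taylor_coeff0 p k * z ^ k) = 1 + p2 * z\<^sup>2" for z
    using p0 p1 by (simp add: eval_nat_numeral p2_def taylor_coeff0_def)
  with M have rem: "cmod (p z - 1 - p2 * z\<^sup>2) \<le> M * cmod z ^ 3" if "cmod z \<le> \<rho>" for z
    using that by (simp add: diff_diff_eq)
  \<comment> \<open>\<open>D\<close> is the total coefficient of \<open>s - \<epsilon>\<close> in
    the bounds \<open>t1\<close> and \<open>t2\<close>.\<close>
  define D where "D = 2 * a + 2 * M"
  have D: "D \<ge> 0" using a M by (simp add: D_def)
  show ?thesis
  proof
    \<comment> \<open>The first witness adds the \<open>\<epsilon>\<^sup>2\<close> coefficients of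
      \<open>t2\<close> and \<open>t3\<close>; the second forces
      \<open>D * \<epsilon> < 1\<close>.\<close>
    show "M + a * (a + M) \<ge> 0" "1 / (D + 1) > 0" using a M D by (auto simp: add_nonneg_pos)
    fix \<epsilon> :: real and z :: complex
    assume \<epsilon>: "0 < \<epsilon>" "\<epsilon> < 1 / (D + 1)" and z: "\<epsilon> \<le> cmod z" "cmod z \<le> \<rho>"
    define s where "s = cmod z"
    have s: "\<epsilon> \<le> s" "s < 1" "s > 0" using \<epsilon> z \<open>\<rho> < 1\<close> by (auto simp: s_def)
    have "z \<noteq> 0" using s by (auto simp: s_def)
    define e where "e = (p z - 1 - p2 * z\<^sup>2) / z"
    have w: "p z / z = 1 / z + p2 * z + e"
      using \<open>z \<noteq> 0\<close> by (simp add: e_def field_simps power2_eq_square)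
    have e: "cmod e \<le> M * s\<^sup>2"
      using rem[OF z(2)] s by (simp add: e_def norm_divide s_def[symmetric] field_simps power3_eq_cube power2_eq_square)
    define \<beta> where "\<beta> = p2 * of_real (\<epsilon>\<^sup>2)"
    have cz: "1 / cnj z = z / of_real (s\<^sup>2)"
      using complex_norm_square[of z] \<open>z \<noteq> 0\<close> by (simp add: s_def field_simps)
    have "p2 * z - \<beta> * (1 / cnj z) = p2 * z * of_real (1 - \<epsilon>\<^sup>2 / s\<^sup>2)"
      unfolding cz \<beta>_def using s by (simp add: field_simps)
    then have "cmod (p2 * z - \<beta> * (1 / cnj z)) = a * s * (1 - \<epsilon>\<^sup>2 / s\<^sup>2)"
      using s \<epsilon> by (simp add: norm_mult a_def s_def[symmetric] del: of_real_diff)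
    also have "\<dots> = a * ((s - \<epsilon>) * ((s + \<epsilon>) / s))"
      using s by (simp add: field_simps power2_eq_square)
    also have "\<dots> \<le> a * ((s - \<epsilon>) * 2)"
      using s a \<epsilon> by (intro mult_left_mono) (auto simp: field_simps)
    finally have t1: "cmod (p2 * z - \<beta> * (1 / cnj z)) \<le> 2 * a * (s - \<epsilon>)" by (simp add: algebra_simps)
    have "(s - \<epsilon>) * (s + \<epsilon>) \<le> (s - \<epsilon>) * 2" using s by (intro mult_left_mono) auto
    then have "s\<^sup>2 \<le> \<epsilon>\<^sup>2 + 2 * (s - \<epsilon>)" by (simp add: algebra_simps power2_eq_square)
    then have "M * s\<^sup>2 \<le> M * (\<epsilon>\<^sup>2 + 2 * (s - \<epsilon>))" using M by (intro mult_left_mono) auto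
    with e have t2: "cmod e \<le> M * \<epsilon>\<^sup>2 + 2 * M * (s - \<epsilon>)" by (simp add: algebra_simps)
    have "cmod (p2 * z + e) \<le> a * s + M * s\<^sup>2"
      by (rule order_trans[OF norm_triangle_ineq]) (use e in \<open>simp add: norm_mult a_def s_def\<close>)
    also have "\<dots> \<le> a * 1 + M * 1"
      using a M s by (intro add_mono mult_left_mono) (auto simp: power_le_one)
    finally have "cmod (\<beta> * cnj (p2 * z + e)) \<le> (a * \<epsilon>\<^sup>2) * (a + M)"
      unfolding norm_mult complex_mod_cnj
      using a by (intro mult_mono) (auto simp: \<beta>_def norm_mult a_def norm_power)
    then have t3: "cmod (\<beta> * cnj (p2 * z + e)) \<le> a * (a + M) * \<epsilon>\<^sup>2" by (simp add: mult_ac)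
    have split: "p z / z - \<beta> * cnj (p z / z) = 1 / z + (p2 * z - \<beta> * (1 / cnj z)) + e - \<beta> * cnj (p2 * z + e)"
      unfolding w by (simp add: algebra_simps)
    have "cmod (p z / z - \<beta> * cnj (p z / z)) \<le> cmod (1 / z) + cmod (p2 * z - \<beta> * (1 / cnj z)) + cmod e
        + cmod (\<beta> * cnj (p2 * z + e))"
      unfolding split
      by (intro order_trans[OF norm_triangle_ineq4] add_mono order_trans[OF norm_triangle_ineq] order_refl)
    also have "\<dots> \<le> 1 / s + 2 * a * (s - \<epsilon>) + (M * \<epsilon>\<^sup>2 + 2 * M * (s - \<epsilon>)) + a * (a + M) * \<epsilon>\<^sup>2"
      by (intro add_mono t1 t2 t3) (simp add: norm_divide s_def)
    also have "\<dots> = 1 / s + D * (s - \<epsilon>) + (M + a * (a + M)) * \<epsilon>\<^sup>2"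
      by (simp add: D_def algebra_simps)
    also have "1 / s + D * (s - \<epsilon>) \<le> 1 / \<epsilon>"
    \<comment> \<open>The drop \<open>1 / \<epsilon> - 1 / s\<close> equals
      \<open>(s - \<epsilon>) / (s * \<epsilon>)\<close>, and
      \<open>D \<le> 1 / (s * \<epsilon>)\<close> because \<open>s < 1\<close>.\<close>
    proof -
      have "\<epsilon> * (D + 1) < 1" using \<epsilon> D by (simp add: field_simps)
      then have "D * \<epsilon> * s \<le> 1 * 1" using \<epsilon> s D by (intro mult_mono) (auto simp: algebra_simps)
      then have "D \<le> 1 / (s * \<epsilon>)" using s \<epsilon> by (simp add: field_simps)
      then have "D * (s - \<epsilon>) \<le> 1 / (s * \<epsilon>) * (s - \<epsilon>)" using s by (intro mult_right_mono) auto
      also have "\<dots> = 1 / \<epsilon> - 1 / s" using s \<epsilon> by (simp add: field_simps)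
      finally show ?thesis by simp
    qed
    finally show "cmod (p z / z - (taylor_coeff0 p 2 * of_real (\<epsilon>\<^sup>2)) * cnj (p z / z))
        \<le> 1 / \<epsilon> + (M + a * (a + M)) * \<epsilon>\<^sup>2"
      by (simp add: \<beta>_def p2_def)
  qed
qed

text \<open>In the annulus inequality the term \<open>k = 0\<close> contributes
  \<open>1 / \<epsilon>\<^sup>2\<close>, which cancels the leading term of the squared radius. The
  radius error has order \<open>\<epsilon>\<^sup>2\<close>, so the cross term in the square has
  order \<epsilon> and vanishes in the limit.\<close>

theorem area_theorem:
  fixes p :: "complex \<Rightarrow> complex"
  assumes hol: "p holomorphic_on ball 0 1" and p0: "p 0 = 1" and p1: "taylor_coeff0 p 1 = 0"
    and inj: "inj_on (\<lambda>z. p z / z) (ball 0 1 - {0})"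
  shows "(\<Sum>k=2..N. (real k - 1) * (cmod (taylor_coeff0 p k))\<^sup>2) \<le> 1"
proof (cases "N \<ge> 2")
  case N: True
  define c where "c k = (real k - 1) * (cmod (taylor_coeff0 p k))\<^sup>2" for k
  define Q where "Q y = (\<Sum>k=2..N. c k * y ^ (2 * (k - 1)))" for y :: real
  define a where "a = cmod (taylor_coeff0 p 2)"
  have Q_bound: "Q \<rho> \<le> 1 / \<rho>\<^sup>2" if \<rho>: "0 < \<rho>" "\<rho> < 1" for \<rho>
  proof -
    obtain C \<epsilon>\<^sub>0 where C: "C \<ge> 0" "\<epsilon>\<^sub>0 > 0"
      "\<And>\<epsilon> z. \<lbrakk>0 < \<epsilon>; \<epsilon> < \<epsilon>\<^sub>0; \<epsilon> \<le> cmod z; cmod z \<le> \<rho>\<rbrakk> \<Longrightarrow>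
         cmod (p z / z - (taylor_coeff0 p 2 * of_real (\<epsilon>\<^sup>2)) * cnj (p z / z)) \<le> 1 / \<epsilon> + C * \<epsilon>\<^sup>2"
      using image_of_annulus_in_near_ellipse[OF hol p0 p1 \<rho>(2)] by metis
    \<comment> \<open>\<open>G\<close> gathers everything that tends to 0 with the inner radius
      \<open>x\<close> once \<open>1 / x\<^sup>2\<close> has cancelled.\<close>
    define G where "G x = Q x + a\<^sup>2 * x\<^sup>2 + a\<^sup>2 * x ^ 4 * (Q \<rho> - 1 / \<rho>\<^sup>2 - Q x) + 2 * C * x + C\<^sup>2 * x ^ 4" for x
    have "continuous_on UNIV G"
      unfolding G_def Q_def by (intro continuous_intros)
    then have "(G \<longlongrightarrow> G 0) (at_right 0)"
      by (auto simp: continuous_on_def intro: tendsto_within_subset)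
    moreover have "Q 0 = 0"
      unfolding Q_def by (rule sum.neutral) auto
    ultimately have lim: "(G \<longlongrightarrow> 0) (at_right 0)" by (simp add: G_def)
    \<comment> \<open>\<open>x < \<rho>\<close> orders the two radii; together with
      \<open>x < 1 / (a + 1)\<close> it yields \<open>cmod \<beta> < 1\<close>.\<close>
    have "Q \<rho> - 1 / \<rho>\<^sup>2 \<le> G x" if x: "0 < x" "x < \<epsilon>\<^sub>0" "x < \<rho>" "x < 1 / (a + 1)" for x
    proof -
      define \<beta> where "\<beta> = taylor_coeff0 p 2 * of_real (x\<^sup>2)"
      have \<beta>: "cmod \<beta> = a * x\<^sup>2" by (simp add: \<beta>_def a_def norm_mult norm_power)
      have "a \<ge> 0" by (simp add: a_def)
      have "a * x\<^sup>2 < 1"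
      proof -
        have "a * x\<^sup>2 \<le> a * x"
          using x \<rho> \<open>a \<ge> 0\<close> by (intro mult_left_mono) (auto simp: power2_eq_square mult_le_cancel_left1)
        also have "\<dots> < 1" using x \<open>a \<ge> 0\<close> by (simp add: field_simps)
        finally show ?thesis .
      qed
      then have "(1 - (cmod \<beta>)\<^sup>2) * (\<Sum>k\<le>N. (real k - 1) * (cmod (taylor_coeff0 p k))\<^sup>2 *
            (exp (2 * (real k - 1) * ln \<rho>) - exp (2 * (real k - 1) * ln x))) \<le> (1 / x + C * x\<^sup>2)\<^sup>2"
      proof (intro annulus_image_area_inequality[OF hol inj])
        show "cmod (p z / z - \<beta> * cnj (p z / z)) \<le> 1 / x + C * x\<^sup>2"
          if "exp (ln x) \<le> cmod z" "cmod z \<le> exp (ln \<rho>)" for z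
          unfolding \<beta>_def by (rule C(3)) (use that x \<rho> in auto)
      qed (use x \<rho> C(1) in \<open>simp_all add: \<beta>\<close>)
      also have "(\<Sum>k\<le>N. (real k - 1) * (cmod (taylor_coeff0 p k))\<^sup>2 *
            (exp (2 * (real k - 1) * ln \<rho>) - exp (2 * (real k - 1) * ln x)))
          = (1 / x\<^sup>2 - 1 / \<rho>\<^sup>2) + (Q \<rho> - Q x)" (is "?L = _")
      proof -
        have ex: "exp (2 * (real k - 1) * ln y) = y ^ (2 * (k - 1))" if "k \<ge> 2" "y > 0" for k y
        proof -
          have "exp (2 * (real k - 1) * ln y) = exp (real (2 * (k - 1)) * ln y)"
            using that by (simp add: of_nat_diff)
          also have "\<dots> = y ^ (2 * (k - 1))"
            using that by (subst exp_of_nat_mult) simp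
          finally show ?thesis .
        qed
        have ex0: "exp (- 2 * ln y) = 1 / y\<^sup>2" if "y > 0" for y :: real
          using that by (simp add: exp_minus exp_double inverse_eq_divide)
        \<comment> \<open>The factor \<open>k - 1\<close> is -1 at \<open>k = 0\<close>, which
          produces the pole term, and 0 at \<open>k = 1\<close>.\<close>
        have "{..N} = insert 0 (insert 1 {2..N})" using N by auto
        moreover have "taylor_coeff0 p 0 = 1" using p0 by (simp add: taylor_coeff0_def)
        ultimately have "?L = - (exp (- 2 * ln \<rho>) - exp (- 2 * ln x)) +
            (\<Sum>k=2..N. c k * (exp (2 * (real k - 1) * ln \<rho>) - exp (2 * (real k - 1) * ln x)))"
          by (simp add: c_def)
        also have "(\<Sum>k=2..N. c k * (exp (2 * (real k - 1) * ln \<rho>) - exp (2 * (real k - 1) * ln x)))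
            = (\<Sum>k=2..N. c k * (\<rho> ^ (2 * (k - 1)) - x ^ (2 * (k - 1))))"
          by (rule sum.cong[OF refl]) (simp only: ex x \<rho> atLeastAtMost_iff)
        also have "- (exp (- 2 * ln \<rho>) - exp (- 2 * ln x)) + (\<Sum>k=2..N. c k * (\<rho> ^ (2 * (k - 1)) - x ^ (2 * (k - 1))))
            = (1 / x\<^sup>2 - 1 / \<rho>\<^sup>2) + (Q \<rho> - Q x)"
          unfolding ex0[OF x(1)] ex0[OF \<rho>(1)]
          by (simp add: Q_def right_diff_distrib sum_subtractf)
        finally show ?thesis .
      qed
      finally have "(1 - (a * x\<^sup>2)\<^sup>2) * ((1 / x\<^sup>2 - 1 / \<rho>\<^sup>2) + (Q \<rho> - Q x)) \<le> (1 / x + C * x\<^sup>2)\<^sup>2"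
        by (simp add: \<beta>)
      moreover have "(1 - (a * x\<^sup>2)\<^sup>2) * ((1 / x\<^sup>2 - 1 / \<rho>\<^sup>2) + (Q \<rho> - Q x))
          = 1 / x\<^sup>2 + (Q \<rho> - 1 / \<rho>\<^sup>2) - (G x - 2 * C * x - C\<^sup>2 * x ^ 4)"
      proof -
        define K where "K = Q \<rho> - 1 / \<rho>\<^sup>2"
        have "(1 - (a * x\<^sup>2)\<^sup>2) * (1 / x\<^sup>2 + K - Q x)
            = 1 / x\<^sup>2 + K - (Q x + a\<^sup>2 * x\<^sup>2 + a\<^sup>2 * x ^ 4 * (K - Q x))"
          using x by (simp add: field_simps power2_eq_square power4_eq_xxxx)
        then show ?thesis by (simp add: K_def G_def algebra_simps)
      qed
      moreover have "(1 / x + C * x\<^sup>2)\<^sup>2 = 1 / x\<^sup>2 + 2 * C * x + C\<^sup>2 * x ^ 4"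
        using x by (simp add: field_simps power2_eq_square power4_eq_xxxx)
      ultimately show ?thesis by linarith
    qed
    moreover have "eventually (\<lambda>x. x \<in> {0<..<min \<epsilon>\<^sub>0 (min \<rho> (1 / (a + 1)))}) (at_right 0)"
      using C(2) \<rho> by (intro eventually_at_right_real) (auto simp: a_def add_nonneg_pos)
    ultimately have "eventually (\<lambda>x. Q \<rho> - 1 / \<rho>\<^sup>2 \<le> G x) (at_right 0)"
      by (auto elim: eventually_mono)
    then have "Q \<rho> - 1 / \<rho>\<^sup>2 \<le> 0"
      by (rule tendsto_lowerbound[OF lim]) simp
    then show ?thesis by simp
  qed
  \<comment> \<open>\<open>Q\<close> is a polynomial, so the inequality passes to the limit as
    \<rho> tends to 1.\<close>
  have "isCont (\<lambda>\<rho>. 1 / \<rho>\<^sup>2 - Q \<rho>) 1"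
    unfolding Q_def by (intro continuous_intros) auto
  then have "((\<lambda>\<rho>. 1 / \<rho>\<^sup>2 - Q \<rho>) \<longlongrightarrow> 1 - Q 1) (at_left 1)"
    by (auto simp: isCont_def intro: tendsto_within_subset)
  moreover have "eventually (\<lambda>\<rho>. 0 \<le> 1 / \<rho>\<^sup>2 - Q \<rho>) (at_left 1)"
    using eventually_at_left_real[of 0 "1::real"] Q_bound by (auto elim!: eventually_mono)
  ultimately have "0 \<le> 1 - Q 1"
    by (rule tendsto_lowerbound) simp
  then show ?thesis by (simp add: Q_def c_def)
qed auto

section \<open>The Hankel determinant of the inverse function\<close>

theorem theorem2:
  fixes f :: "complex \<Rightarrow> complex"
  assumes "f holomorphic_on ball 0 1"
    and "inj_on f (ball 0 1)"
    and "f 0 = 0"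
    and "deriv f 0 = 1"
    and "taylor_coeff0 f 2 = 0"
  shows "cmod (taylor_coeff0 (inv_into (ball 0 1) f) 3 * taylor_coeff0 (inv_into (ball 0 1) f) 5
              - (taylor_coeff0 (inv_into (ball 0 1) f) 4)^2)
         \<le> sqrt 3 / (6 * sqrt 7) + 2 * sqrt 3"
proof -
  \<comment> \<open>\<open>q\<close> is \<open>f z / z\<close> with the singularity removed, spelled
    with \<open>f 0\<close> and \<open>z - 0\<close> to fit \<open>pole_lemma_open\<close>.\<close>
  define q where "q z = (if z = 0 then deriv f 0 else (f z - f 0) / (z - 0))" for z
  define p where "p z = inverse (q z)" for z
  have f_nz: "f z \<noteq> 0" if "z \<in> ball 0 1" "z \<noteq> 0" for z
    using inj_onD[OF assms(2), of z 0] that assms(3) by auto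
  have q_hol: "q holomorphic_on ball 0 1"
    unfolding q_def[abs_def] by (rule pole_lemma_open[OF assms(1)]) simp
  have p_hol: "p holomorphic_on ball 0 1"
    unfolding p_def by (rule holomorphic_on_inverse[OF q_hol]) (use assms(3,4) f_nz in \<open>auto simp: q_def\<close>)
  have p_over_z: "p z / z = 1 / f z" if "z \<noteq> 0" for z
    using that assms(3) by (simp add: p_def q_def)
  have p0: "p 0 = 1" using assms(4) by (simp add: p_def q_def)
  define P where "P = fps_expansion p 0"
  have P: "p has_fps_expansion P" unfolding P_def
    by (rule has_fps_expansion_fps_expansion[OF _ _ p_hol]) auto
  note p_coeff = has_fps_expansion_taylor_coeff0[OF P]
  have P0: "fps_nth P 0 = 1" using p_coeff[of 0] p0 by (simp add: taylor_coeff0_def)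
  \<comment> \<open>Compare the coefficients of the square of \<open>z\<close> in
    \<open>p z * f z = z\<close>; this is where the vanishing second coefficient of \<open>f\<close>
    enters.\<close>
  have P1: "fps_nth P 1 = 0"
  proof -
    define \<Phi> where "\<Phi> = fps_expansion f 0"
    have \<Phi>: "f has_fps_expansion \<Phi>" unfolding \<Phi>_def
      by (rule has_fps_expansion_fps_expansion[OF _ _ assms(1)]) auto
    have "(\<lambda>z. p z * f z) has_fps_expansion P * \<Phi>"
      by (intro fps_expansion_intros P \<Phi>)
    moreover have "eventually (\<lambda>z. p z * f z = z) (nhds 0)"
      using eventually_nhds_in_open[of "ball 0 1" "0::complex"]
      by (rule eventually_mono) (use assms(3) f_nz in \<open>auto simp: p_def q_def\<close>)
    ultimately have "(\<lambda>z. z) has_fps_expansion P * \<Phi>"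
      by (subst (asm) has_fps_expansion_cong) auto
    from has_fps_expansion_taylor_coeff0[OF this, of 2]
      has_fps_expansion_taylor_coeff0[OF has_fps_expansion_fps_X, of 2]
    have "fps_nth (P * \<Phi>) 2 = 0" by simp
    moreover have "fps_nth \<Phi> 0 = 0" "fps_nth \<Phi> 1 = 1" "fps_nth \<Phi> 2 = 0"
      using assms(3-5) unfolding has_fps_expansion_taylor_coeff0[OF \<Phi>, symmetric]
      by (simp_all add: taylor_coeff0_def)
    ultimately show ?thesis using P0 by (simp add: fps_mult_nth eval_nat_numeral)
  qed
  define g where "g = inv_into (ball 0 1) f"
  define A where "A = fps_expansion g 0"
  have g: "g (f z) = z" if "z \<in> ball 0 1" for z
    unfolding g_def by (rule inv_into_f_f[OF assms(2) that])
  have img_open: "open (f ` ball 0 1)"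
    by (rule open_mapping_thm3[OF assms(1) _ assms(2)]) simp
  have img_0: "0 \<in> f ` ball 0 1"
    using assms(3) by (metis centre_in_ball imageI zero_less_one)
  have "g holomorphic_on f ` ball 0 1"
  proof -
    \<comment> \<open>Some holomorphic inverse exists; it agrees with \<open>inv_into\<close> on the
      image of the disc.\<close>
    obtain g' where "g' holomorphic_on f ` ball 0 1" "\<And>z. z \<in> ball 0 1 \<Longrightarrow> g' (f z) = z"
      using holomorphic_has_inverse[OF assms(1) _ assms(2)] by (metis open_ball)
    then show ?thesis
      by (elim holomorphic_transform) (use g in auto)
  qed
  then have A: "g has_fps_expansion A" unfolding A_def
    by (rule has_fps_expansion_fps_expansion[OF img_open img_0])
  have "g 0 = 0" using g[of 0] assms(3) by simp
  then have A0: "fps_nth A 0 = 0"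
    using has_fps_expansion_taylor_coeff0[OF A, of 0] by (simp add: taylor_coeff0_def)
  have "A = fps_X * (P oo A)"
  proof -
    have "(\<lambda>w. w * (p \<circ> g) w) has_fps_expansion fps_X * (P oo A)"
      by (intro fps_expansion_intros P A A0)
    moreover have "eventually (\<lambda>w. w * (p \<circ> g) w = g w) (nhds 0)"
      using eventually_nhds_in_open[OF img_open img_0]
    proof (rule eventually_mono)
      fix w assume "w \<in> f ` ball 0 1"
      then obtain z where "z \<in> ball 0 1" "w = f z" by blast
      then show "w * (p \<circ> g) w = g w"
        using g[of z] f_nz[of z] assms(3) by (cases "z = 0") (auto simp: p_def q_def)
    qed
    ultimately have "g has_fps_expansion fps_X * (P oo A)"
      by (subst (asm) has_fps_expansion_cong) auto
    with A show ?thesis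
      by (intro fps_ext) (metis has_fps_expansion_taylor_coeff0)
  qed
  \<comment> \<open>As \<open>A\<close> has no constant term, the right side involves only
    coefficients of \<open>A\<close> up to index \<open>n\<close>, so they can be computed one after
    another.\<close>
  then have A_rec: "fps_nth A (Suc n) = fps_nth (P oo A) n" for n
    by (metis fps_mult_fps_X_plus_1_nth fps_X_mult_nth nat.simps(3) diff_Suc_1)
  have A1: "fps_nth A 1 = 1" using A_rec[of 0] P0 A0 by (simp add: fps_compose_nth)
  have A2: "fps_nth A 2 = 0"
    using A_rec[of 1] P1 A0 by (simp add: fps_compose_nth eval_nat_numeral)
  have A3: "fps_nth A 3 = fps_nth P 2"
    using A_rec[of 2] P1 A0 A1 by (simp add: fps_compose_nth fps_mult_nth eval_nat_numeral)
  have A4: "fps_nth A 4 = fps_nth P 3"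
    using A_rec[of 3] P1 A0 A1 A2 by (simp add: fps_compose_nth fps_mult_nth eval_nat_numeral)
  \<comment> \<open>The square of \<open>A\<close> has fourth coefficient
    \<open>2 * fps_nth A 3\<close>, which gives the quadratic term; the cube contributes nothing
    since \<open>A2\<close> vanishes.\<close>
  have A5: "fps_nth A 5 = 2 * (fps_nth P 2)\<^sup>2 + fps_nth P 4"
    using A_rec[of 4] P1 A0 A1 A2 A3 by (simp add: fps_compose_nth fps_mult_nth eval_nat_numeral)
  have "inj_on (\<lambda>z. p z / z) (ball 0 1 - {0})"
    by (rule inj_onI) (auto simp: p_over_z dest: inj_onD[OF assms(2)])
  moreover have "taylor_coeff0 p 1 = 0" by (simp only: p_coeff P1)
  ultimately have "(\<Sum>k=2..4. (real k - 1) * (cmod (taylor_coeff0 p k))\<^sup>2) \<le> 1"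
    by (intro area_theorem[OF p_hol p0])
  then
  have area: "(cmod (fps_nth P 2))\<^sup>2 + 2 * (cmod (fps_nth P 3))\<^sup>2 + 3 * (cmod (fps_nth P 4))\<^sup>2 \<le> 1"
    by (simp add: p_coeff eval_nat_numeral)
  define x y z where "x = cmod (fps_nth P 2)" and "y = cmod (fps_nth P 3)" and "z = cmod (fps_nth P 4)"
  have nonneg: "x \<ge> 0" "y \<ge> 0" "z \<ge> 0" by (simp_all add: x_def y_def z_def)
  have xyz: "x\<^sup>2 + 2 * y\<^sup>2 + 3 * z\<^sup>2 \<le> 1" using area by (simp add: x_def y_def z_def)
  have "cmod (fps_nth A 3 * fps_nth A 5 - (fps_nth A 4)\<^sup>2)
      = cmod (2 * fps_nth P 2 ^ 3 + fps_nth P 2 * fps_nth P 4 - (fps_nth P 3)\<^sup>2)"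
    by (simp add: A3 A4 A5 algebra_simps power3_eq_cube power2_eq_square)
  also have "\<dots> \<le> 2 * x ^ 3 + x * z + y\<^sup>2"
    by (rule order_trans[OF norm_triangle_ineq4], intro add_mono order_trans[OF norm_triangle_ineq])
       (simp_all add: norm_mult norm_power x_def y_def z_def)
  also have "\<dots> \<le> 2 + 1 / 2"
  \<comment> \<open>The cubic term is at most 2; the rest is at most half of
    \<open>x\<^sup>2 + z\<^sup>2 + 2 * y\<^sup>2\<close>, hence at most 1/2.\<close>
  proof -
    have "x\<^sup>2 \<le> 1" using xyz zero_le_power2[of y] zero_le_power2[of z] by linarith
    then have "x ^ 3 \<le> 1" using nonneg by (simp add: power_le_one abs_square_le_1)
    moreover have "2 * x * z \<le> x\<^sup>2 + z\<^sup>2" by (rule sum_squares_bound)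
    ultimately show ?thesis using xyz zero_le_power2[of z] by linarith
  qed
  also have "\<dots> \<le> 2 * sqrt 3"
    \<comment> \<open>After squaring, this is 25/4 against 12.\<close>
    by (rule power2_le_imp_le) (auto simp: power_mult_distrib power_divide)
  also have "\<dots> \<le> sqrt 3 / (6 * sqrt 7) + 2 * sqrt 3" by simp
  finally show ?thesis
    by (simp add: has_fps_expansion_taylor_coeff0[OF A] flip: g_def)
qed

end
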